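(* If $\Gamma(t)>1$ for some $t\in(0,1/2)$, then $p_A\ge t$ for any (nonempty) OR-closed set $A\subseteq\{0,1\}^n$ (i.e., for any nonempty union-closed family $\mathcal F$ of subsets of $\{1,\dots,n\}$, there exists an element of $\{1,\dots,n\}$ contained in at least a proportion $t$ of the sets of $\mathcal F$).
   Context: Setting. $n\ge1$ is an integer. For $x,y\in\{0,1\}^n$, $x\vee y:=(x_i\vee y_i)_{i}$ is the coordinatewise OR. A set $A\subseteq\{0,1\}^n$ is OR-closed if $x\vee y\in A$ for all $x,y\in A$. Identifying each subset of $\{1,\dots,n\}$ with its indicator sequence in $\{0,1\}^n$, OR-closed sets $A$ correspond to union-closed families $\mathcal F$. For a nonempty $A\subseteq\{0,1\}^n$, let $X^n=(X_1,\dots,X_n)$ be uniformly distributed on $A$ and set $p_A:=\max_{1\le i\le n}\Pr(X_i=1)$. Binary entropy: $h(a)=-a\log_2 a-(1-a)\log_2(1-a)$ for $a\in[0,1]$ (with $0\log_2 0=0$). Symmetric couplings: for a finitely supported distribution $P_p$ on $[0,1]$, $\mathcal C_{\mathrm s}(P_p)$ is the set of joint distributions $P_{pq}$ both of whose marginals equal $P_p$ and which satisfy $P_{pq}(x,y)=P_{pq}(y,x)$ for all $x,y$. Maximal correlation: for a pair of random variables $(X,Y)$, $$\rho_{\mathrm m}(X;Y)=\sup_{f,g}\rho_{\mathrm p}(f(X);g(Y)),$$ the supremum being over all pairs of real-valued functions $f,g$ with $\mathrm{Var}(f(X))\mathrm{Var}(g(Y))<\infty$, where $\rho_{\mathrm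 p}(U;V)=\frac{\mathrm{Cov}(U,V)}{\sqrt{\mathrm{Var}(U)\mathrm{Var}(V)}}$ if $\mathrm{Var}(U)\mathrm{Var}(V)>0$ and $\rho_{\mathrm p}(U;V)=0$ if $\mathrm{Var}(U)\mathrm{Var}(V)=0$. The function $\varphi$: for $p,q,\rho\in[0,1]$ let $z_1:=pq-\rho\sqrt{p(1-p)q(1-q)}$, $z_2:=pq+\rho\sqrt{p(1-p)q(1-q)}$, and $$\varphi(\rho,p,q):=\mathrm{median}\left\{\max\{p,q,p+q-z_2\},\ 1/2,\ \min\{p+q,p+q-z_1\}\right\},$$ where the median is of the three listed numbers regarded as a multiset (so $\mathrm{median}\{a,a,b\}=a$). The function $\Gamma$: for $t>0$, $$\Gamma(t):=\sup_{P_\rho}\ \inf_{P_p:\ \mathbb E h(p)>0,\ \mathbb E p\le t}\ \mathbb E_{\rho\sim P_\rho}\left[\inf_{P_{pq}\in\mathcal C_{\mathrm s}(P_p):\ \rho_{\mathrm m}(p;q)\le\rho}\frac{\mathbb E_{(p,q)\sim P_{pq}}h(\varphi(\rho,p,q))}{\mathbb E h(p)}\right],$$ where the supremum over $P_\rho$ and the outer infimum over $P_p$ are both taken over all finitely supported probability distributions on $[0,1]$ (with $p\sim P_p$ in $\mathbb E h(p)$ and $\mathbb E p$).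
   Formalization: The formal theorem excludes the OR-closed set A = {0^n} (and the family F consisting only of the empty set), for which p_A = 0 < t and the claim as worded is false. *)

theory Defs
  imports "HOL-Probability.Probability"
begin

text \<open>
  \<open>{0,1}^n\<close> is the extensional function space \<open>{1..n} \<rightarrow>\<^sub>E UNIV\<close> over \<open>bool\<close>, with \<open>True\<close> as 1.
\<close>

definition cube :: "nat \<Rightarrow> (nat \<Rightarrow> bool) set" where
  "cube n = {1..n} \<rightarrow>\<^sub>E UNIV"

definition zero_seq :: "nat \<Rightarrow> nat \<Rightarrow> bool" where
  "zero_seq n = (\<lambda>i\<in>{1..n}. False)"

definition or_seq :: "nat \<Rightarrow> (nat \<Rightarrow> bool) \<Rightarrow> (nat \<Rightarrow> bool) \<Rightarrow> nat \<Rightarrow> bool" where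
  "or_seq n x y = (\<lambda>i\<in>{1..n}. x i \<or> y i)"

definition or_closed :: "nat \<Rightarrow> (nat \<Rightarrow> bool) set \<Rightarrow> bool" where
  "or_closed n A \<longleftrightarrow> (\<forall>x\<in>A. \<forall>y\<in>A. or_seq n x y \<in> A)"

definition p_max :: "nat \<Rightarrow> (nat \<Rightarrow> bool) set \<Rightarrow> real" where
  "p_max n A = Max ((\<lambda>i. measure_pmf.prob (pmf_of_set A) {x. x i}) ` {1..n})"

definition union_closed :: "'a set set \<Rightarrow> bool" where
  "union_closed F \<longleftrightarrow> (\<forall>S\<in>F. \<forall>T\<in>F. S \<union> T \<in> F)"

text \<open>The convention \<open>0 log 0 = 0\<close> holds automatically, since \<open>0 * y = 0\<close>.\<close>

definition bin_entropy :: "real \<Rightarrow> real" where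
  "bin_entropy a = - a * log 2 a - (1 - a) * log 2 (1 - a)"

definition covariance :: "'c pmf \<Rightarrow> ('c \<Rightarrow> real) \<Rightarrow> ('c \<Rightarrow> real) \<Rightarrow> real" where
  "covariance P U V = measure_pmf.expectation P
     (\<lambda>w. (U w - measure_pmf.expectation P U) * (V w - measure_pmf.expectation P V))"

definition pearson_corr :: "'c pmf \<Rightarrow> ('c \<Rightarrow> real) \<Rightarrow> ('c \<Rightarrow> real) \<Rightarrow> real" where
  "pearson_corr P U V =
     (if measure_pmf.variance P U * measure_pmf.variance P V > 0
      then covariance P U V / sqrt (measure_pmf.variance P U * measure_pmf.variance P V)
      else 0)"

text \<open>
  Finiteness of the variances is expressed as square integrability (equivalent on a probability
  space; integrals of non-integrable functions are 0 by convention, so the variance itself cannot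
  express it).  The supremum is over a nonempty set that is bounded by 1 (Cauchy-Schwarz).
\<close>

definition maximal_corr :: "('a \<times> 'b) pmf \<Rightarrow> real" where
  "maximal_corr Q = Sup {pearson_corr Q (\<lambda>z. f (fst z)) (\<lambda>z. g (snd z)) | f g.
     integrable (measure_pmf Q) (\<lambda>z. (f (fst z))\<^sup>2) \<and>
     integrable (measure_pmf Q) (\<lambda>z. (g (snd z))\<^sup>2)}"

definition fin_dists :: "real pmf set" where
  "fin_dists = {P. finite (set_pmf P) \<and> set_pmf P \<subseteq> {0..1}}"

definition sym_couplings :: "'a pmf \<Rightarrow> ('a \<times> 'a) pmf set" where
  "sym_couplings P = {Q. map_pmf fst Q = P \<and> map_pmf snd Q = P \<and>
     (\<forall>x y. pmf Q (x, y) = pmf Q (y, x))}"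

definition median3 :: "'a::linorder \<Rightarrow> 'a \<Rightarrow> 'a \<Rightarrow> 'a" where
  "median3 a b c = sort [a, b, c] ! 1"

definition phi :: "real \<Rightarrow> real \<Rightarrow> real \<Rightarrow> real" where
  "phi \<rho> p q =
     (let z1 = p * q - \<rho> * sqrt (p * (1 - p) * q * (1 - q));
          z2 = p * q + \<rho> * sqrt (p * (1 - p) * q * (1 - q))
      in median3 (max (max p q) (p + q - z2)) (1 / 2) (min (p + q) (p + q - z1)))"

text \<open>
  For \<open>t > 0\<close> all infima and suprema below are over nonempty bounded sets: the inner quotients
  are nonnegative, the product coupling has maximal correlation 0, and the point mass at
  \<open>min t (1/2)\<close> is feasible for the outer infimum and bounds it independently of \<open>R\<close>.
\<close>

definition Gamma_fun :: "real \<Rightarrow> real" where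
  "Gamma_fun t =
     (SUP R \<in> fin_dists.
        INF P \<in> {P \<in> fin_dists. measure_pmf.expectation P bin_entropy > 0 \<and>
                                measure_pmf.expectation P (\<lambda>p. p) \<le> t}.
          measure_pmf.expectation R (\<lambda>\<rho>.
            INF Q \<in> {Q \<in> sym_couplings P. maximal_corr Q \<le> \<rho>}.
              measure_pmf.expectation Q (\<lambda>(p, q). bin_entropy (phi \<rho> p q)) /
              measure_pmf.expectation P bin_entropy))"

end

theory Submission
  imports Defs
begin

text \<open>
  Suppose that every coordinate of a uniform random element \<open>X\<close> of the OR-closed set \<open>A\<close> is 1 with
  probability less than \<open>t\<close>. If \<open>X\<close> and \<open>Y\<close> are both uniform on \<open>A\<close>, coupled in any way, then
  \<open>X \<or> Y\<close> lies in \<open>A\<close>, so its entropy is at most \<open>log |A| = H(X)\<close>. When \<open>\<Gamma>(t) > 1\<close> there is a coupling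
  for which this fails.

  For given \<open>\<rho>\<close> the coupling reveals the coordinates in order. After the prefixes \<open>u\<close> and \<open>v\<close>, the next
  bits of \<open>X\<close> and \<open>Y\<close> have conditional probabilities \<open>p(u)\<close> and \<open>p(v)\<close> of being 1, and they are coupled
  with correlation at most \<open>\<rho>\<close> so that their OR is as close to a fair coin as possible; its success
  probability is then \<open>\<phi>(\<rho>, p(u), p(v))\<close>. Two facts drive the argument.

  \<^item> Maximal correlation does not grow under this procedure (\<open>corr_le_bind\<close>). So at each stage the pair
    \<open>(p(u), p(v))\<close> has a symmetric law of maximal correlation at most \<open>\<rho>\<close>, whose marginals are the law
    \<open>P\<^sub>i\<close> of \<open>p(u)\<close>; it competes in the inner infimum defining \<open>\<Gamma>\<close> (\<open>coupling_ratio_le_gain\<close>).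

  \<^item> The entropy of \<open>X \<or> Y\<close> is at least the sum over the coordinates of \<open>E h(\<phi>(\<rho>, p(u), p(v)))\<close>
    (\<open>sum_gain_le\<close>), because the OR of the prefixes says less about the next bit than the prefixes do.
    The entropy of \<open>X\<close> is exactly the sum of \<open>E h(p(u))\<close> (\<open>shannon_prefix_law\<close>).

  The mean of \<open>P\<^sub>i\<close> is the probability that coordinate \<open>i + 1\<close> is 1, hence at most \<open>t\<close>. If \<open>\<Gamma>(t) > 1\<close>,
  some law of \<open>\<rho>\<close> and some \<open>c > 1\<close> make the average over \<open>\<rho>\<close> of \<open>E h(\<phi>)\<close> at least \<open>c E h(p)\<close> for every
  coordinate. Summed up, the average over \<open>\<rho>\<close> of \<open>H(X \<or> Y)\<close> is at least \<open>c log |A|\<close>, which exceeds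
  \<open>log |A|\<close> as soon as \<open>A\<close> has two elements. Union-closed families are the same objects, by way of
  indicator sequences.
\<close>

section \<open>Expectations over finitely supported distributions\<close>

abbreviation expect :: "'a pmf \<Rightarrow> ('a \<Rightarrow> real) \<Rightarrow> real" where
  "expect P f \<equiv> measure_pmf.expectation P f"

lemma expect_bind:
  assumes "finite (set_pmf P)" "\<And>x. x \<in> set_pmf P \<Longrightarrow> finite (set_pmf (K x))"
  shows "expect (bind_pmf P K) h = expect P (\<lambda>x. expect (K x) h)"
  using assms
  by (simp add: pmf_expectation_bind[OF assms order_refl] integral_measure_pmf[OF assms(1)])

lemma expect_mono:
  assumes "finite (set_pmf P)" "\<And>x. x \<in> set_pmf P \<Longrightarrow> f x \<le> g x"
  shows "expect P f \<le> expect P g"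
  using assms by (intro integral_mono_AE integrable_measure_pmf_finite) (auto simp: AE_measure_pmf_iff)

lemma expect_cong:
  assumes "\<And>x. x \<in> set_pmf P \<Longrightarrow> f x = g x"
  shows "expect P f = expect P g"
  using assms by (intro integral_cong_AE) (auto simp: AE_measure_pmf_iff)

lemma expect_nonneg:
  assumes "\<And>x. x \<in> set_pmf P \<Longrightarrow> 0 \<le> f x"
  shows "0 \<le> expect P f"
  using assms by (intro integral_nonneg_AE) (auto simp: AE_measure_pmf_iff)

lemma expect_linear:
  assumes "finite (set_pmf P)"
  shows "expect P (\<lambda>x. f x + g x) = expect P f + expect P g"
    and "expect P (\<lambda>x. f x - g x) = expect P f - expect P g"
    and "expect P (\<lambda>x. - f x) = - expect P f"
    and "expect P (\<lambda>x. c * f x) = c * expect P f"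
    and "expect P (\<lambda>x. c) = c"
  using assms by (simp_all add: integrable_measure_pmf_finite)

lemma pmf_bind_Pair:
  assumes "finite (set_pmf C)"
  shows "pmf (bind_pmf C (\<lambda>c. map_pmf (Pair c) (K c))) (c, b) = pmf C c * pmf (K c) b"
proof -
  have "pmf (map_pmf (Pair d) (K d)) (c, b) = (if d = c then pmf (K c) b else 0)" for d
  proof (cases "d = c")
    case True
    then show ?thesis using pmf_map_inj'[of "Pair c" "K c" b] by (simp add: inj_on_def)
  next
    case False
    then show ?thesis by (auto intro!: pmf_map_outside)
  qed
  then have "pmf (bind_pmf C (\<lambda>c. map_pmf (Pair c) (K c))) (c, b)
      = expect C (\<lambda>d. if d = c then pmf (K c) b else 0)"
    by (simp add: pmf_bind)
  also have "\<dots> = (\<Sum>d\<in>set_pmf C. if d = c then pmf C c * pmf (K c) b else 0)"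
    using assms by (subst integral_measure_pmf[of "set_pmf C"]) (auto simp del: sum.delta intro!: sum.cong)
  also have "\<dots> = pmf C c * pmf (K c) b"
    using assms by (auto simp: sum.delta set_pmf_iff)
  finally show ?thesis .
qed

text \<open>
  Where the first component has probability 0, the quotient is \<open>0 / 0 = 0\<close>, a legitimate Bernoulli
  parameter.
\<close>

lemma disintegrate_bit:
  fixes J :: "('a \<times> bool) pmf"
  assumes "finite (set_pmf J)"
  shows "J = bind_pmf (map_pmf fst J) (\<lambda>u. map_pmf (Pair u)
    (bernoulli_pmf (pmf J (u, True) / pmf (map_pmf fst J) u)))" (is "_ = ?R")
proof (rule pmf_eqI)
  fix w :: "'a \<times> bool"
  obtain u b where w: "w = (u, b)" by fastforce
  let ?M = "map_pmf fst J"
  have "pmf ?M u = measure J {(u, True), (u, False)}"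
    unfolding pmf_map by (rule arg_cong[of _ _ "measure J"]) (auto simp: set_eq_iff)
  then have M: "pmf ?M u = pmf J (u, True) + pmf J (u, False)"
    by (simp add: measure_measure_pmf_finite)
  have *: "pmf ?R (u, b) = pmf ?M u * pmf (bernoulli_pmf (pmf J (u, True) / pmf ?M u)) b"
    using assms by (intro pmf_bind_Pair) simp
  have "0 \<le> pmf J (u, True) / pmf ?M u" "pmf J (u, True) / pmf ?M u \<le> 1"
    using pmf_nonneg[of J "(u, True)"] pmf_nonneg[of J "(u, False)"]
    by (simp_all add: M divide_le_eq_1 del: pmf_nonneg) linarith
  moreover have "pmf J (u, True) \<ge> 0" "pmf J (u, False) \<ge> 0" by simp_all
  ultimately have "pmf ?R (u, b) = pmf J (u, b)"
    unfolding * by (cases b; cases "pmf ?M u = 0") (auto simp: M field_simps add_nonneg_eq_0_iff)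
  then show "pmf J w = pmf ?R w" by (simp add: w)
qed

section \<open>Shannon entropy\<close>

definition shannon :: "'a pmf \<Rightarrow> real" where
  "shannon P = expect P (\<lambda>x. - log 2 (pmf P x))"

text \<open>
  Coding with the wrong weights \<open>g\<close> costs at least the entropy, by \<open>ln x \<le> x - 1\<close>. Only a
  sub-probability is required of \<open>g\<close>, so that conditional laws restricted to the support of \<open>P\<close> and
  the uniform weights on a superset of it are both covered. Because the bound is linear in \<open>P\<close>, it
  replaces every appeal to concavity of the entropy.
\<close>

lemma gibbs:
  assumes "finite (set_pmf P)" "\<And>x. x \<in> set_pmf P \<Longrightarrow> 0 < g x" "(\<Sum>x\<in>set_pmf P. g x) \<le> 1"
  shows "shannon P \<le> expect P (\<lambda>x. - log 2 (g x))"
proof -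
  have "shannon P - expect P (\<lambda>x. - log 2 (g x)) = expect P (\<lambda>x. log 2 (g x) - log 2 (pmf P x))"
    unfolding shannon_def using assms(1) by (simp add: expect_linear)
  also have "\<dots> \<le> expect P (\<lambda>x. 1 / ln 2 * (g x / pmf P x - 1))"
  proof (rule expect_mono[OF assms(1)])
    fix x assume x: "x \<in> set_pmf P"
    then have p: "0 < pmf P x" and g: "0 < g x" by (auto simp: pmf_positive assms)
    then have "log 2 (g x) - log 2 (pmf P x) = ln (g x / pmf P x) / ln 2"
      by (simp add: log_def ln_div diff_divide_distrib)
    also have "\<dots> \<le> (g x / pmf P x - 1) / ln 2"
      using p g by (intro divide_right_mono ln_le_minus_one) auto
    finally show "log 2 (g x) - log 2 (pmf P x) \<le> 1 / ln 2 * (g x / pmf P x - 1)" by simp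
  qed
  also have "\<dots> = (expect P (\<lambda>x. g x / pmf P x) - 1) / ln 2"
    by (simp only: expect_linear[OF assms(1)]) simp
  also have "expect P (\<lambda>x. g x / pmf P x) = (\<Sum>x\<in>set_pmf P. g x)"
    using assms(1) by (subst integral_measure_pmf[of "set_pmf P"]) (auto simp: set_pmf_iff intro!: sum.cong)
  also have "((\<Sum>x\<in>set_pmf P. g x) - 1) / ln 2 \<le> 0"
    using assms(3) by (simp add: divide_le_0_iff)
  finally show ?thesis by simp
qed

lemma shannon_le_log_card:
  assumes "finite A" "set_pmf P \<subseteq> A"
  shows "shannon P \<le> log 2 (card A)"
proof -
  have fin: "finite (set_pmf P)" using assms finite_subset by blast
  have c: "0 < card A" using assms set_pmf_not_empty[of P] by (auto simp: card_gt_0_iff)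
  have "shannon P \<le> expect P (\<lambda>x. - log 2 (1 / card A))"
    using c card_mono[OF assms] by (intro gibbs fin) auto
  also have "\<dots> = log 2 (card A)" using c by (simp add: log_divide)
  finally show ?thesis .
qed

lemma shannon_pmf_of_set:
  assumes "finite A" "A \<noteq> {}"
  shows "shannon (pmf_of_set A) = log 2 (card A)"
proof -
  have "shannon (pmf_of_set A) = expect (pmf_of_set A) (\<lambda>x. log 2 (card A))"
    unfolding shannon_def using assms by (intro expect_cong) (auto simp: log_divide card_gt_0_iff)
  then show ?thesis by simp
qed

lemma shannon_bernoulli:
  assumes "0 \<le> p" "p \<le> 1"
  shows "shannon (bernoulli_pmf p) = bin_entropy p"
  using assms by (simp add: shannon_def bin_entropy_def)

lemma shannon_nonneg: "0 \<le> shannon P"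
  unfolding shannon_def
proof (rule expect_nonneg)
  fix x assume "x \<in> set_pmf P"
  then have "0 < pmf P x" by (simp add: pmf_positive)
  then show "0 \<le> - log 2 (pmf P x)" by (simp add: pmf_le_1)
qed

lemma bin_entropy_nonneg: "0 \<le> p \<Longrightarrow> p \<le> 1 \<Longrightarrow> 0 \<le> bin_entropy p"
  using shannon_nonneg[of "bernoulli_pmf p"] by (simp add: shannon_bernoulli)

lemma shannon_map_inj:
  assumes "inj_on f (set_pmf P)"
  shows "shannon (map_pmf f P) = shannon P"
  unfolding shannon_def integral_map_pmf
  by (intro expect_cong) (simp add: pmf_map_inj assms)

text \<open>
  The chain rule \<open>H(C, B) = H(C) + H(B | C)\<close>, where \<open>K c\<close> is the law of \<open>B\<close> given \<open>C = c\<close>.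
\<close>

lemma shannon_chain:
  assumes "finite (set_pmf C)" "\<And>c. c \<in> set_pmf C \<Longrightarrow> finite (set_pmf (K c))"
  shows "shannon (bind_pmf C (\<lambda>c. map_pmf (Pair c) (K c)))
    = shannon C + expect C (\<lambda>c. shannon (K c))"
proof -
  let ?J = "bind_pmf C (\<lambda>c. map_pmf (Pair c) (K c))"
  have "shannon ?J = expect C (\<lambda>c. expect (K c) (\<lambda>b. - log 2 (pmf ?J (c, b))))"
    unfolding shannon_def using assms by (subst expect_bind) auto
  also have "\<dots> = expect C (\<lambda>c. - log 2 (pmf C c) + shannon (K c))"
  proof (rule expect_cong)
    fix c assume c: "c \<in> set_pmf C"
    have "expect (K c) (\<lambda>b. - log 2 (pmf ?J (c, b)))
        = expect (K c) (\<lambda>b. - log 2 (pmf C c) + - log 2 (pmf (K c) b))"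
      using c by (intro expect_cong) (simp add: pmf_bind_Pair assms(1) log_mult pmf_positive less_imp_neq[THEN not_sym])
    also have "\<dots> = - log 2 (pmf C c) + shannon (K c)"
      unfolding shannon_def using assms(2)[OF c] by (subst expect_linear) auto
    finally show "expect (K c) (\<lambda>b. - log 2 (pmf ?J (c, b))) = - log 2 (pmf C c) + shannon (K c)" .
  qed
  also have "\<dots> = shannon C + expect C (\<lambda>c. shannon (K c))"
    unfolding shannon_def[of C] using assms(1) by (rule expect_linear)
  finally show ?thesis .
qed

text \<open>
  This is \<open>H(\<zeta>(C), B) \<ge> H(\<zeta>(C)) + H(B | C)\<close>: conditioning on the coarser variable \<open>\<zeta>(C)\<close> can only
  leave more uncertainty about \<open>B\<close>. It holds because, for each value \<open>c\<close>, the conditional law of \<open>B\<close>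
  given \<open>\<zeta>(C) = \<zeta> c\<close> is one particular choice of weights in Gibbs' inequality for \<open>K c\<close>.
\<close>

lemma shannon_chain_le:
  assumes "finite (set_pmf C)" "\<And>c. c \<in> set_pmf C \<Longrightarrow> finite (set_pmf (K c))"
  shows "shannon (map_pmf \<zeta> C) + expect C (\<lambda>c. shannon (K c))
    \<le> shannon (bind_pmf C (\<lambda>c. map_pmf (Pair (\<zeta> c)) (K c)))"
proof -
  let ?M = "map_pmf \<zeta> C"
  define J where "J = bind_pmf C (\<lambda>c. map_pmf (Pair (\<zeta> c)) (K c))"
  have M: "map_pmf fst J = ?M"
    by (simp add: J_def map_bind_pmf map_pmf_comp map_pmf_def[of \<zeta>])
  have "shannon ?M + expect C (\<lambda>c. shannon (K c))
      = expect C (\<lambda>c. - log 2 (pmf ?M (\<zeta> c)) + shannon (K c))"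
    unfolding shannon_def[of ?M] integral_map_pmf using assms(1) by (rule expect_linear(1)[symmetric])
  also have "\<dots> \<le> expect C (\<lambda>c. expect (K c) (\<lambda>b. - log 2 (pmf J (\<zeta> c, b))))"
  proof (rule expect_mono[OF assms(1)])
    fix c assume c: "c \<in> set_pmf C"
    let ?u = "\<zeta> c"
    note fin = assms(2)[OF c]
    have m: "0 < pmf ?M ?u" using c by (intro pmf_positive) auto
    have j: "0 < pmf J (?u, b)" if "b \<in> set_pmf (K c)" for b
      using c that by (intro pmf_positive) (auto simp: J_def)
    have "(\<Sum>b\<in>set_pmf (K c). pmf J (?u, b)) = measure J (Pair ?u ` set_pmf (K c))"
      using fin by (subst measure_measure_pmf_finite) (auto simp: sum.reindex inj_on_def)
    also have "\<dots> \<le> measure J (fst -` {?u})"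
      by (intro measure_pmf.finite_measure_mono) auto
    also have "\<dots> = pmf ?M ?u" by (simp add: M[symmetric] pmf_map)
    finally have "(\<Sum>b\<in>set_pmf (K c). pmf J (?u, b) / pmf ?M ?u) \<le> 1"
      using m by (simp add: sum_divide_distrib[symmetric])
    then have "shannon (K c) \<le> expect (K c) (\<lambda>b. - log 2 (pmf J (?u, b) / pmf ?M ?u))"
      using m j by (intro gibbs fin) auto
    also have "\<dots> = expect (K c) (\<lambda>b. log 2 (pmf ?M ?u) + - log 2 (pmf J (?u, b)))"
      using m j by (intro expect_cong) (simp add: log_divide less_imp_neq[THEN not_sym])
    also have "\<dots> = log 2 (pmf ?M ?u) + expect (K c) (\<lambda>b. - log 2 (pmf J (?u, b)))"
      using fin by (subst expect_linear) auto
    finally show "- log 2 (pmf ?M ?u) + shannon (K c) \<le> expect (K c) (\<lambda>b. - log 2 (pmf J (?u, b)))"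
      by simp
  qed
  also have "\<dots> = shannon J"
    unfolding shannon_def using assms by (simp add: J_def expect_bind)
  finally show ?thesis by (simp add: J_def)
qed

section \<open>Bounding the maximal correlation\<close>

lemma covariance_finite:
  assumes "finite (set_pmf P)"
  shows "covariance P U V = expect P (\<lambda>w. U w * V w) - expect P U * expect P V"
proof -
  let ?u = "expect P U" and ?v = "expect P V"
  have "covariance P U V = expect P (\<lambda>w. U w * V w - ?v * U w - (?u * V w - ?u * ?v))"
    unfolding covariance_def by (intro expect_cong) (simp add: algebra_simps)
  also have "\<dots> = expect P (\<lambda>w. U w * V w) - ?v * ?u - (?u * ?v - ?u * ?v)"
    by (simp only: expect_linear[OF assms])
  finally show ?thesis by simp
qed

lemma variance_finite:
  assumes "finite (set_pmf P)"
  shows "measure_pmf.variance P U = expect P (\<lambda>w. (U w)\<^sup>2) - (expect P U)\<^sup>2"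
  using covariance_finite[OF assms, of U U] by (simp add: covariance_def power2_eq_square)

text \<open>
  That the maximal correlation is at most \<open>\<rho>\<close> means \<open>Cov(f, g) \<le> \<rho> sqrt(Var f Var g)\<close> for all \<open>f\<close> and
  \<open>g\<close>. The geometric mean of the variances is replaced here by the arithmetic one, which is
  equivalent for \<open>\<rho> \<ge> 0\<close> since \<open>f\<close> and \<open>g\<close> can be rescaled independently. In this form the bound is
  linear in the variances, so it can be added up along a disintegration of the law.
\<close>

definition corr_le :: "real \<Rightarrow> ('a \<times> 'b) pmf \<Rightarrow> bool" where
  "corr_le \<rho> Q \<longleftrightarrow> (\<forall>f g. 2 * covariance Q (\<lambda>z. f (fst z)) (\<lambda>z. g (snd z))
     \<le> \<rho> * (measure_pmf.variance Q (\<lambda>z. f (fst z)) + measure_pmf.variance Q (\<lambda>z. g (snd z))))"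

text \<open>
  The variances see only the marginals; this form is used when the marginals are known.
\<close>

lemma corr_le_iff:
  assumes "finite (set_pmf Q)"
  shows "corr_le \<rho> Q \<longleftrightarrow> (\<forall>f g.
    2 * (expect Q (\<lambda>z. f (fst z) * g (snd z)) - expect (map_pmf fst Q) f * expect (map_pmf snd Q) g)
      \<le> \<rho> * ((expect (map_pmf fst Q) (\<lambda>x. (f x)\<^sup>2) - (expect (map_pmf fst Q) f)\<^sup>2)
           + (expect (map_pmf snd Q) (\<lambda>y. (g y)\<^sup>2) - (expect (map_pmf snd Q) g)\<^sup>2)))"
  by (simp add: corr_le_def covariance_finite[OF assms] variance_finite[OF assms])

lemma maximal_corr_le:
  fixes Q :: "('a \<times> 'b) pmf"
  assumes fin: "finite (set_pmf Q)" and "0 \<le> \<rho>" and Q: "corr_le \<rho> Q"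
  shows "maximal_corr Q \<le> \<rho>"
  unfolding maximal_corr_def
proof (rule cSup_least, goal_cases)
  case 1
  show ?case using fin by (auto intro!: exI integrable_measure_pmf_finite)
next
  case (2 r)
  then obtain f g where r: "r = pearson_corr Q (\<lambda>z. f (fst z)) (\<lambda>z. g (snd z))" by blast
  define U V :: "'a \<times> 'b \<Rightarrow> real" where "U = (\<lambda>z. f (fst z))" and "V = (\<lambda>z. g (snd z))"
  define v w where "v = measure_pmf.variance Q U" and "w = measure_pmf.variance Q V"
  have nonneg: "0 \<le> v" "0 \<le> w" by (simp_all add: v_def w_def)
  show ?case
  proof (cases "v * w > 0")
    case False
    then show ?thesis using \<open>0 \<le> \<rho>\<close> by (simp add: r pearson_corr_def v_def w_def U_def V_def)
  next
    case True
    then have pos: "0 < v" "0 < w" using nonneg by (auto simp: zero_less_mult_iff)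
    \<comment> \<open>With both functions scaled to variance 1, the two means of the variances coincide.\<close>
    define a b where "a = 1 / sqrt v" and "b = 1 / sqrt w"
    have "2 * covariance Q (\<lambda>z. a * U z) (\<lambda>z. b * V z)
        \<le> \<rho> * (measure_pmf.variance Q (\<lambda>z. a * U z) + measure_pmf.variance Q (\<lambda>z. b * V z))"
      using Q[unfolded corr_le_def, rule_format, of "\<lambda>x. a * f x" "\<lambda>y. b * g y"]
      by (simp add: U_def V_def)
    moreover have "covariance Q (\<lambda>z. a * U z) (\<lambda>z. b * V z) = covariance Q U V / sqrt (v * w)"
    proof -
      have "covariance Q (\<lambda>z. a * U z) (\<lambda>z. b * V z) = expect Q (\<lambda>z. (a * b) * (U z * V z)) - a * b * (expect Q U * expect Q V)"
        by (simp add: covariance_finite[OF fin] expect_linear[OF fin] mult_ac del: integral_mult_right_zero integral_mult_left_zero)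
      also have "\<dots> = (a * b) * covariance Q U V"
        unfolding expect_linear(4)[OF fin] covariance_finite[OF fin] by (simp add: algebra_simps)
      finally show ?thesis by (simp add: a_def b_def real_sqrt_mult)
    qed
    moreover have "measure_pmf.variance Q (\<lambda>z. a * U z) = a\<^sup>2 * v" 
      "measure_pmf.variance Q (\<lambda>z. b * V z) = b\<^sup>2 * w"
      by (simp_all add: v_def w_def power_mult_distrib flip: right_diff_distrib)
    ultimately have "2 * (covariance Q U V / sqrt (v * w)) \<le> \<rho> * 2"
      using pos by (simp add: a_def b_def power_divide)
    then show ?thesis using True by (simp add: r pearson_corr_def v_def w_def U_def V_def)
  qed
qed

lemma corr_le_map:
  assumes "corr_le \<rho> Q"
  shows "corr_le \<rho> (map_pmf (map_prod \<alpha> \<beta>) Q)"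
  unfolding corr_le_def
proof (intro allI)
  fix f g
  show "2 * covariance (map_pmf (map_prod \<alpha> \<beta>) Q) (\<lambda>z. f (fst z)) (\<lambda>z. g (snd z))
     \<le> \<rho> * (measure_pmf.variance (map_pmf (map_prod \<alpha> \<beta>) Q) (\<lambda>z. f (fst z))
        + measure_pmf.variance (map_pmf (map_prod \<alpha> \<beta>) Q) (\<lambda>z. g (snd z)))"
    using assms[unfolded corr_le_def, rule_format, of "\<lambda>x. f (\<alpha> x)" "\<lambda>y. g (\<beta> y)"]
    by (simp add: covariance_def)
qed

lemma corr_le_pair:
  assumes "finite (set_pmf P)" "finite (set_pmf Q)" "0 \<le> \<rho>"
  shows "corr_le \<rho> (pair_pmf P Q)"
proof -
  have "expect (pair_pmf P Q) (\<lambda>z. f (fst z) * g (snd z)) = expect P f * expect Q g" for f g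
    using assms by (simp add: pair_pmf_def expect_bind)
  moreover have "0 \<le> expect R (\<lambda>x. (f x)\<^sup>2) - (expect R f)\<^sup>2" if "finite (set_pmf R)" for R :: "'c pmf" and f
    using variance_finite[OF that, of f] measure_pmf.variance_positive[of R f] by simp
  note this[OF assms(1)] this[OF assms(2)]
  ultimately show ?thesis
    using assms by (auto simp: corr_le_iff map_fst_pair_pmf map_snd_pair_pmf intro!: mult_nonneg_nonneg add_nonneg_nonneg)
qed

text \<open>
  Maximal correlation is stable under sequential sampling: if \<open>U\<close> and \<open>V\<close> have maximal correlation at
  most \<open>\<rho>\<close>, and given \<open>U = u\<close>, \<open>V = v\<close> a further pair is drawn with maximal correlation at most \<open>\<rho>\<close>
  and with marginals that depend on \<open>u\<close> alone and on \<open>v\<close> alone, then the extended pair obeys the same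
  bound. Writing \<open>F\<close> and \<open>G\<close> for the conditional means of \<open>f\<close> and \<open>g\<close>, the laws of total covariance and
  total variance split the claim into the hypothesis on \<open>(U, V)\<close> applied to \<open>F\<close>, \<open>G\<close> and the average of
  the hypotheses on the conditional pairs; the marginal condition is what makes \<open>F\<close> a function of \<open>u\<close>.
\<close>

lemma corr_le_bind:
  fixes Q :: "('a \<times> 'b) pmf" and K :: "'a \<Rightarrow> 'b \<Rightarrow> ('c \<times> 'd) pmf"
  assumes fin: "finite (set_pmf Q)" "\<And>u v. (u, v) \<in> set_pmf Q \<Longrightarrow> finite (set_pmf (K u v))"
    and marg: "\<And>u v. (u, v) \<in> set_pmf Q \<Longrightarrow> map_pmf fst (K u v) = M u"
      "\<And>u v. (u, v) \<in> set_pmf Q \<Longrightarrow> map_pmf snd (K u v) = N v"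
    and Q: "corr_le \<rho> Q" and K: "\<And>u v. (u, v) \<in> set_pmf Q \<Longrightarrow> corr_le \<rho> (K u v)"
  shows "corr_le \<rho> (bind_pmf Q (\<lambda>(u, v). map_pmf (\<lambda>(a, b). ((u, a), (v, b))) (K u v)))"
    (is "corr_le \<rho> ?B")
proof -
  have finB: "finite (set_pmf ?B)" using fin by auto
  have B: "expect ?B h = expect Q (\<lambda>(u, v). expect (K u v) (\<lambda>(a, b). h ((u, a), (v, b))))" for h
    using fin by (subst expect_bind) (auto simp: case_prod_unfold)
  have B1: "expect (map_pmf fst ?B) h = expect Q (\<lambda>z. expect (M (fst z)) (\<lambda>a. h (fst z, a)))" for h
    unfolding integral_map_pmf B
    by (intro expect_cong) (auto simp: case_prod_unfold marg(1)[symmetric])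
  have B2: "expect (map_pmf snd ?B) h = expect Q (\<lambda>z. expect (N (snd z)) (\<lambda>b. h (snd z, b)))" for h
    unfolding integral_map_pmf B
    by (intro expect_cong) (auto simp: case_prod_unfold marg(2)[symmetric])
  show ?thesis
    unfolding corr_le_iff[OF finB]
  proof (intro allI)
    fix f :: "'a \<times> 'c \<Rightarrow> real" and g :: "'b \<times> 'd \<Rightarrow> real"
    define F F2 where "F = (\<lambda>u. expect (M u) (\<lambda>a. f (u, a)))"
      and "F2 = (\<lambda>u. expect (M u) (\<lambda>a. (f (u, a))\<^sup>2))"
    define G G2 where "G = (\<lambda>v. expect (N v) (\<lambda>b. g (v, b)))"
      and "G2 = (\<lambda>v. expect (N v) (\<lambda>b. (g (v, b))\<^sup>2))"
    have FG: "expect (map_pmf fst ?B) f = expect Q (\<lambda>z. F (fst z))"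
      "expect (map_pmf fst ?B) (\<lambda>x. (f x)\<^sup>2) = expect Q (\<lambda>z. F2 (fst z))"
      "expect (map_pmf snd ?B) g = expect Q (\<lambda>z. G (snd z))"
      "expect (map_pmf snd ?B) (\<lambda>y. (g y)\<^sup>2) = expect Q (\<lambda>z. G2 (snd z))"
      unfolding B1 B2 F_def F2_def G_def G2_def by (rule refl)+
    have "expect ?B (\<lambda>z. f (fst z) * g (snd z))
        \<le> expect Q (\<lambda>z. F (fst z) * G (snd z)
          + \<rho> / 2 * ((F2 (fst z) - (F (fst z))\<^sup>2) + (G2 (snd z) - (G (snd z))\<^sup>2)))"
      unfolding B
    proof (rule expect_mono[OF fin(1)])
      fix z assume z: "z \<in> set_pmf Q"
      obtain u v where uv: "z = (u, v)" by fastforce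
      note K[OF z[unfolded uv], unfolded corr_le_iff[OF fin(2)[OF z[unfolded uv]]]
          marg[OF z[unfolded uv]], rule_format, of "\<lambda>a. f (u, a)" "\<lambda>b. g (v, b)"]
      then show "(case z of (u, v) \<Rightarrow> expect (K u v) (\<lambda>(a, b). f (fst ((u, a), (v, b))) * g (snd ((u, a), (v, b)))))
          \<le> F (fst z) * G (snd z)
            + \<rho> / 2 * ((F2 (fst z) - (F (fst z))\<^sup>2) + (G2 (snd z) - (G (snd z))\<^sup>2))"
        by (simp add: uv F_def F2_def G_def G2_def case_prod_unfold)
    qed
    also have "\<dots> = expect Q (\<lambda>z. F (fst z) * G (snd z))
        + \<rho> / 2 * ((expect Q (\<lambda>z. F2 (fst z)) - expect Q (\<lambda>z. (F (fst z))\<^sup>2))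
          + (expect Q (\<lambda>z. G2 (snd z)) - expect Q (\<lambda>z. (G (snd z))\<^sup>2)))"
      by (simp only: expect_linear[OF fin(1)])
    finally have inner: "expect ?B (\<lambda>z. f (fst z) * g (snd z)) \<le> \<dots>" .
    have outer: "2 * (expect Q (\<lambda>z. F (fst z) * G (snd z)) - expect Q (\<lambda>z. F (fst z)) * expect Q (\<lambda>z. G (snd z)))
      \<le> \<rho> * ((expect Q (\<lambda>z. (F (fst z))\<^sup>2) - (expect Q (\<lambda>z. F (fst z)))\<^sup>2)
           + (expect Q (\<lambda>z. (G (snd z))\<^sup>2) - (expect Q (\<lambda>z. G (snd z)))\<^sup>2))"
      using Q[unfolded corr_le_iff[OF fin(1)], rule_format, of F G] by simp
    show "2 * (expect ?B (\<lambda>z. f (fst z) * g (snd z)) - expect (map_pmf fst ?B) f * expect (map_pmf snd ?B) g)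
      \<le> \<rho> * ((expect (map_pmf fst ?B) (\<lambda>x. (f x)\<^sup>2) - (expect (map_pmf fst ?B) f)\<^sup>2)
           + (expect (map_pmf snd ?B) (\<lambda>y. (g y)\<^sup>2) - (expect (map_pmf snd ?B) g)\<^sup>2))"
      unfolding FG using inner outer by (simp add: algebra_simps)
  qed
qed

section \<open>Coupling two bits\<close>

lemma expect_bool_pair:
  "expect Q h = pmf Q (True, True) * h (True, True) + pmf Q (True, False) * h (True, False)
    + pmf Q (False, True) * h (False, True) + pmf Q (False, False) * h (False, False)"
  for Q :: "(bool \<times> bool) pmf"
  by (subst integral_measure_pmf[of UNIV]) (auto simp: UNIV_Times_UNIV[symmetric] UNIV_bool simp del: UNIV_Times_UNIV)

lemma bool_pmf_eqI:
  assumes "pmf P True = p"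
  shows "P = bernoulli_pmf p"
proof (rule pmf_eqI)
  have "0 \<le> p" "p \<le> 1" using assms pmf_le_1[of P True] pmf_nonneg[of P True] by auto
  then show "pmf P b = pmf (bernoulli_pmf p) b" for b
    using assms by (cases b) (auto simp: pmf_False_conv_True)
qed

text \<open>
  The law of two bits with success probabilities \<open>p\<close> and \<open>q\<close> is determined by the probability \<open>s\<close> that
  at least one of them is 1; the locale below collects the conditions on \<open>s\<close> under which it exists.
\<close>

definition bit_weight :: "real \<Rightarrow> real \<Rightarrow> real \<Rightarrow> bool \<times> bool \<Rightarrow> real" where
  "bit_weight p q s = (\<lambda>(a, b).
     if a then (if b then p + q - s else s - q) else (if b then s - p else 1 - s))"

definition bit_coupling :: "real \<Rightarrow> real \<Rightarrow> real \<Rightarrow> (bool \<times> bool) pmf" where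
  "bit_coupling p q s = embed_pmf (bit_weight p q s)"

locale or_prob =
  fixes p q s :: real
  assumes p01: "0 \<le> p" "p \<le> 1" and q01: "0 \<le> q" "q \<le> 1"
    and s: "p \<le> s" "q \<le> s" "s \<le> 1" "s \<le> p + q"
begin

lemma pmf_bit_coupling: "pmf (bit_coupling p q s) = bit_weight p q s"
proof -
  have nonneg: "0 \<le> bit_weight p q s z" for z
    using p01 q01 s by (auto simp: bit_weight_def split: prod.splits)
  have "(\<Sum>z\<in>UNIV. bit_weight p q s z) = 1"
    by (simp add: UNIV_Times_UNIV[symmetric] UNIV_bool bit_weight_def del: UNIV_Times_UNIV)
  then have "(\<integral>\<^sup>+z. ennreal (bit_weight p q s z) \<partial>count_space UNIV) = 1"
    using nonneg by (simp add: nn_integral_count_space_finite sum_ennreal)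
  then show ?thesis using nonneg by (intro ext) (simp add: bit_coupling_def pmf_embed_pmf)
qed

lemma map_bit_coupling:
  "map_pmf fst (bit_coupling p q s) = bernoulli_pmf p"
  "map_pmf snd (bit_coupling p q s) = bernoulli_pmf q"
  "map_pmf (\<lambda>(a, b). a \<or> b) (bit_coupling p q s) = bernoulli_pmf s"
proof -
  have *: "map_pmf f (bit_coupling p q s) = bernoulli_pmf r"
    if "expect (bit_coupling p q s) (\<lambda>z. of_bool (f z)) = r" for f r
  proof -
    have "r = expect (map_pmf f (bit_coupling p q s)) of_bool" using that by simp
    also have "\<dots> = pmf (map_pmf f (bit_coupling p q s)) True"
      by (subst integral_measure_pmf[of UNIV]) (auto simp: UNIV_bool)
    finally show ?thesis by (intro bool_pmf_eqI) simp
  qed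
  show "map_pmf fst (bit_coupling p q s) = bernoulli_pmf p"
    "map_pmf snd (bit_coupling p q s) = bernoulli_pmf q"
    "map_pmf (\<lambda>(a, b). a \<or> b) (bit_coupling p q s) = bernoulli_pmf s"
    by (auto intro!: * simp: expect_bool_pair pmf_bit_coupling bit_weight_def)
qed

text \<open>
  For bits, \<open>f\<close> and \<open>g\<close> are affine in the bit, so the covariance of the two bits, which is
  \<open>(p + q - s) - p q\<close>, controls every covariance.
\<close>

lemma corr_le_bit_coupling:
  assumes \<rho>: "0 \<le> \<rho>" and z: "\<bar>p + q - s - p * q\<bar> \<le> \<rho> * sqrt (p * (1 - p) * q * (1 - q))"
  shows "corr_le \<rho> (bit_coupling p q s)"
proof -
  have "2 * ((f True - f False) * (g True - g False) * (p + q - s - p * q))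
      \<le> \<rho> * ((f True - f False)\<^sup>2 * (p * (1 - p)) + (g True - g False)\<^sup>2 * (q * (1 - q)))"
    for f g :: "bool \<Rightarrow> real"
  proof -
    define b d where "b = f True - f False" and "d = g True - g False"
    define x y where "x = sqrt (p * (1 - p))" and "y = sqrt (q * (1 - q))"
    have xy: "0 \<le> x" "0 \<le> y" "x\<^sup>2 = p * (1 - p)" "y\<^sup>2 = q * (1 - q)"
      "sqrt (p * (1 - p) * q * (1 - q)) = x * y"
      using p01 q01 by (simp_all add: x_def y_def flip: real_sqrt_mult mult.assoc)
    have "b * d * (p + q - s - p * q) \<le> \<bar>b * d\<bar> * (\<rho> * (x * y))"
      using mult_left_mono[OF z[unfolded xy(5)] abs_ge_zero, of "b * d"] abs_ge_self[of "b * d * (p + q - s - p * q)"]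
      by (simp only: abs_mult)
    moreover have "2 * (\<bar>b * d\<bar> * (\<rho> * (x * y))) \<le> \<rho> * (b\<^sup>2 * x\<^sup>2 + d\<^sup>2 * y\<^sup>2)"
    proof -
      have "0 \<le> (\<bar>b\<bar> * x - \<bar>d\<bar> * y)\<^sup>2" by simp
      then have "2 * (\<bar>b\<bar> * \<bar>d\<bar> * x * y) \<le> b\<^sup>2 * x\<^sup>2 + d\<^sup>2 * y\<^sup>2"
        by (simp add: power2_diff power_mult_distrib algebra_simps)
      then have "\<rho> * (2 * (\<bar>b\<bar> * \<bar>d\<bar> * x * y)) \<le> \<rho> * (b\<^sup>2 * x\<^sup>2 + d\<^sup>2 * y\<^sup>2)"
        using \<rho> by (rule mult_left_mono)
      then show ?thesis by (simp add: abs_mult algebra_simps)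
    qed
    ultimately show ?thesis unfolding b_def[symmetric] d_def[symmetric] xy(3,4)[symmetric] by linarith
  qed
  then show ?thesis
    using p01 q01
    by (subst corr_le_iff)
       (simp_all add: map_bit_coupling expect_bool_pair pmf_bit_coupling bit_weight_def
         power2_eq_square algebra_simps)
qed

end

text \<open>
  Exchanging the two bits exchanges \<open>p\<close> and \<open>q\<close>. This yields the symmetry of the coupled prefixes that
  membership in \<^const>\<open>sym_couplings\<close> demands.
\<close>

lemma map_swap_bit_coupling:
  assumes "or_prob p q s"
  shows "map_pmf prod.swap (bit_coupling p q s) = bit_coupling q p s"
proof (rule pmf_eqI)
  interpret or_prob p q s by fact
  interpret swap: or_prob q p s using p01 q01 s by unfold_locales auto
  fix z
  have "pmf (map_pmf prod.swap (bit_coupling p q s)) (prod.swap (prod.swap z)) = pmf (bit_coupling q p s) z"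
    unfolding pmf_map_inj'[OF inj_swap]
    by (cases z) (auto simp: pmf_bit_coupling swap.pmf_bit_coupling bit_weight_def)
  then show "pmf (map_pmf prod.swap (bit_coupling p q s)) z = pmf (bit_coupling q p s) z" by simp
qed

lemma median3_sorted:
  "a \<le> c \<Longrightarrow> median3 a b c = (if b \<le> a then a else if c \<le> b then c else b)"
  by (auto simp: median3_def)

lemma phi_commute: "phi \<rho> p q = phi \<rho> q p"
  by (simp add: phi_def Let_def mult_ac max.commute add.commute)

text \<open>
  The outer numbers in the median are the ends of the interval of those \<open>s\<close> that keep the covariance
  of the bits within \<open>\<rho>\<close> times the product of their standard deviations and \<open>s\<close> between \<open>max p q\<close> and
  \<open>p + q\<close>. Thus \<^const>\<open>phi\<close> picks the admissible \<open>s\<close> closest to \<open>1/2\<close>, that is, the one of largest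
  entropy. It never exceeds 1: it is above \<open>1/2\<close> only when it equals the lower end,
  which is at most \<open>p + q - p q = 1 - (1 - p) (1 - q)\<close> or one of \<open>p\<close> and \<open>q\<close>.
\<close>

lemma
  assumes "0 \<le> p" "p \<le> 1" "0 \<le> q" "q \<le> 1" and \<rho>: "0 \<le> \<rho>"
  shows or_prob_phi: "or_prob p q (phi \<rho> p q)"
    and phi_near_product: "\<bar>p + q - phi \<rho> p q - p * q\<bar> \<le> \<rho> * sqrt (p * (1 - p) * q * (1 - q))"
proof -
  define d where "d = \<rho> * sqrt (p * (1 - p) * q * (1 - q))"
  have d: "0 \<le> d" using assms by (simp add: d_def)
  have pq: "p * q \<le> p" "p * q \<le> q" "0 \<le> p * q" "p + q - p * q \<le> 1"
    using assms mult_left_le[of q p] mult_left_le[of p q] mult_nonneg_nonneg[of "1 - p" "1 - q"]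
    by (auto simp: algebra_simps)
  define lo where "lo = max (max p q) (p + q - (p * q + d))"
  define hi where "hi = min (p + q) (p + q - (p * q - d))"
  have lh: "lo \<le> hi" using assms d pq by (auto simp: lo_def hi_def)
  have phi: "phi \<rho> p q = (if 1 / 2 \<le> lo then lo else if hi \<le> 1 / 2 then hi else 1 / 2)"
    unfolding phi_def Let_def d_def[symmetric] lo_def[symmetric] hi_def[symmetric] by (rule median3_sorted[OF lh])
  have lo': "lo \<le> phi \<rho> p q" and hi': "phi \<rho> p q \<le> hi" using lh unfolding phi by (simp_all split: if_splits)
  have "phi \<rho> p q \<le> max (1 / 2) lo" unfolding phi by (simp split: if_splits)
  then have "phi \<rho> p q \<le> 1" using assms d pq by (auto simp: lo_def)
  with lo' hi' show "or_prob p q (phi \<rho> p q)" by unfold_locales (use assms in \<open>auto simp: lo_def hi_def\<close>)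
  show "\<bar>p + q - phi \<rho> p q - p * q\<bar> \<le> \<rho> * sqrt (p * (1 - p) * q * (1 - q))"
    using lo' hi' unfolding d_def[symmetric] by (auto simp: lo_def hi_def)
qed

section \<open>The sequential coupling\<close>

definition prefix_law :: "(nat \<Rightarrow> bool) pmf \<Rightarrow> nat \<Rightarrow> (nat \<Rightarrow> bool) pmf" where
  "prefix_law X i = map_pmf (\<lambda>x. restrict x {1..i}) X"

text \<open>
  The conditional probability that coordinate \<open>i + 1\<close> is 1 when the first \<open>i\<close> coordinates are \<open>u\<close>;
  it is 0 for a prefix \<open>u\<close> that does not occur.
\<close>

definition next_prob :: "(nat \<Rightarrow> bool) pmf \<Rightarrow> nat \<Rightarrow> (nat \<Rightarrow> bool) \<Rightarrow> real" where
  "next_prob X i u = measure X {x. restrict x {1..i} = u \<and> x (Suc i)}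
     / measure X {x. restrict x {1..i} = u}"

definition snoc :: "nat \<Rightarrow> (nat \<Rightarrow> bool) \<times> bool \<Rightarrow> nat \<Rightarrow> bool" where
  "snoc i = (\<lambda>(u, b). u(Suc i := b))"

lemma snoc_restrict: "snoc i (restrict x {1..i}, x (Suc i)) = restrict x {1..Suc i}"
  by (auto simp: snoc_def fun_eq_iff restrict_def)

lemma or_seq_snoc: "or_seq (Suc i) (snoc i (u, a)) (snoc i (v, b)) = snoc i (or_seq i u v, a \<or> b)"
  by (auto simp: snoc_def or_seq_def fun_eq_iff restrict_def)

lemma inj_on_snoc: "inj_on (snoc i) (cube i \<times> UNIV)"
proof (rule inj_onI, clarify)
  fix u v a b assume u: "u \<in> cube i" "v \<in> cube i" and eq: "snoc i (u, a) = snoc i (v, b)"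
  have "w (Suc i) = undefined" if "w \<in> cube i" for w
    using that unfolding cube_def by (rule PiE_arb) simp
  note this[OF u(1)] this[OF u(2)]
  moreover have "(snoc i (u, a))(Suc i := undefined) = (snoc i (v, b))(Suc i := undefined)" "a = b"
    using eq by (auto simp: snoc_def dest: fun_cong[of _ _ "Suc i"])
  ultimately show "u = v \<and> a = b" by (simp add: snoc_def fun_upd_idem)
qed

lemma next_prob_bounds: "0 \<le> next_prob X i u" "next_prob X i u \<le> 1"
proof -
  have "measure X {x. restrict x {1..i} = u \<and> x (Suc i)} \<le> measure X {x. restrict x {1..i} = u}"
    by (intro measure_pmf.finite_measure_mono) auto
  then show "next_prob X i u \<le> 1" by (simp add: next_prob_def divide_le_eq_1 less_le)
qed (simp add: next_prob_def)

lemma set_prefix_law: "set_pmf (prefix_law X i) \<subseteq> cube i"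
  by (auto simp: prefix_law_def cube_def)

lemma joint_next:
  assumes "finite (set_pmf X)"
  shows "map_pmf (\<lambda>x. (restrict x {1..i}, x (Suc i))) X
    = bind_pmf (prefix_law X i) (\<lambda>u. map_pmf (Pair u) (bernoulli_pmf (next_prob X i u)))"
proof -
  let ?J = "map_pmf (\<lambda>x. (restrict x {1..i}, x (Suc i))) X"
  have fst: "map_pmf fst ?J = prefix_law X i" by (simp add: prefix_law_def map_pmf_comp)
  have "pmf ?J (u, True) / pmf (map_pmf fst ?J) u = next_prob X i u" for u
    unfolding next_prob_def fst prefix_law_def pmf_map by (simp add: vimage_def)
  then show ?thesis
    using disintegrate_bit[of ?J] assms unfolding fst by simp
qed

lemma prefix_law_Suc:
  assumes "finite (set_pmf X)"
  shows "prefix_law X (Suc i)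
    = bind_pmf (prefix_law X i) (\<lambda>u. map_pmf (\<lambda>b. snoc i (u, b)) (bernoulli_pmf (next_prob X i u)))"
proof -
  have "prefix_law X (Suc i) = map_pmf (snoc i) (map_pmf (\<lambda>x. (restrict x {1..i}, x (Suc i))) X)"
    by (simp add: prefix_law_def map_pmf_comp snoc_restrict del: One_nat_def)
  then show ?thesis unfolding joint_next[OF assms] by (simp add: map_bind_pmf map_pmf_comp)
qed

lemma expect_next_prob:
  assumes "finite (set_pmf X)"
  shows "expect (prefix_law X i) (next_prob X i) = measure X {x. x (Suc i)}"
proof -
  have "measure X {x. x (Suc i)} = expect X (indicator {x. x (Suc i)})" by simp
  also have "\<dots> = expect X (\<lambda>x. of_bool (x (Suc i)))"
    by (intro expect_cong) (simp add: indicator_def)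
  also have "\<dots> = expect (map_pmf (\<lambda>x. (restrict x {1..i}, x (Suc i))) X) (\<lambda>z. of_bool (snd z))"
    by simp
  also have "\<dots> = expect (prefix_law X i) (next_prob X i)"
    unfolding joint_next[OF assms]
    by (subst expect_bind) (use assms in \<open>auto simp: prefix_law_def next_prob_bounds\<close>)
  finally show ?thesis ..
qed

text \<open>
  The chain rule for the entropy of a random sequence, read coordinate by coordinate.
\<close>

lemma shannon_prefix_law:
  assumes "finite (set_pmf X)"
  shows "shannon (prefix_law X n) = (\<Sum>i<n. expect (prefix_law X i) (\<lambda>u. bin_entropy (next_prob X i u)))"
proof (induction n)
  case 0
  have "prefix_law X 0 = return_pmf (\<lambda>_. undefined)"
    by (simp add: prefix_law_def restrict_def map_pmf_const)
  then show ?case by (simp add: shannon_def)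
next
  case (Suc n)
  let ?J = "bind_pmf (prefix_law X n) (\<lambda>u. map_pmf (Pair u) (bernoulli_pmf (next_prob X n u)))"
  have "prefix_law X (Suc n) = map_pmf (snoc n) ?J"
    by (simp add: prefix_law_Suc[OF assms] map_bind_pmf map_pmf_comp)
  moreover have "inj_on (snoc n) (set_pmf ?J)"
    by (rule inj_on_subset[OF inj_on_snoc]) (use set_prefix_law in auto)
  ultimately have "shannon (prefix_law X (Suc n)) = shannon ?J" by (simp add: shannon_map_inj)
  also have "\<dots> = shannon (prefix_law X n) + expect (prefix_law X n) (\<lambda>u. shannon (bernoulli_pmf (next_prob X n u)))"
    using assms by (intro shannon_chain) (auto simp: prefix_law_def)
  finally show ?case by (simp add: Suc shannon_bernoulli next_prob_bounds)
qed

definition next_coupling :: "real \<Rightarrow> (nat \<Rightarrow> bool) pmf \<Rightarrow> nat \<Rightarrow> (nat \<Rightarrow> bool) \<Rightarrow> (nat \<Rightarrow> bool) \<Rightarrow> (bool \<times> bool) pmf" where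
  "next_coupling \<rho> X i u v = bit_coupling (next_prob X i u) (next_prob X i v)
     (phi \<rho> (next_prob X i u) (next_prob X i v))"

text \<open>
  Two copies of the random sequence are revealed one coordinate at a time. Given the prefixes \<open>u\<close> and
  \<open>v\<close> seen so far, the next bits keep their own conditional laws and are coupled so that their OR is 1
  with probability \<open>phi \<rho> p q\<close>.
\<close>

primrec coupled :: "real \<Rightarrow> (nat \<Rightarrow> bool) pmf \<Rightarrow> nat \<Rightarrow> ((nat \<Rightarrow> bool) \<times> (nat \<Rightarrow> bool)) pmf" where
  "coupled \<rho> X 0 = return_pmf (\<lambda>_. undefined, \<lambda>_. undefined)"
| "coupled \<rho> X (Suc i) = bind_pmf (coupled \<rho> X i) (\<lambda>(u, v).
     map_pmf (\<lambda>(a, b). (snoc i (u, a), snoc i (v, b))) (next_coupling \<rho> X i u v))"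

locale coupling_process =
  fixes \<rho> :: real and X :: "(nat \<Rightarrow> bool) pmf"
  assumes rho: "0 \<le> \<rho>" and finX: "finite (set_pmf X)"
begin

lemma or_prob_next: "or_prob (next_prob X i u) (next_prob X i v) (phi \<rho> (next_prob X i u) (next_prob X i v))"
  by (intro or_prob_phi next_prob_bounds rho)

lemma map_next_coupling:
  "map_pmf fst (next_coupling \<rho> X i u v) = bernoulli_pmf (next_prob X i u)"
  "map_pmf snd (next_coupling \<rho> X i u v) = bernoulli_pmf (next_prob X i v)"
  "map_pmf (\<lambda>(a, b). a \<or> b) (next_coupling \<rho> X i u v)
    = bernoulli_pmf (phi \<rho> (next_prob X i u) (next_prob X i v))"
  "map_pmf prod.swap (next_coupling \<rho> X i u v) = next_coupling \<rho> X i v u"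
  unfolding next_coupling_def
  by (simp_all add: or_prob.map_bit_coupling[OF or_prob_next] map_swap_bit_coupling[OF or_prob_next] phi_commute)

lemma finite_coupled: "finite (set_pmf (coupled \<rho> X i))"
  by (induction i) auto

lemma coupled_marginals:
  "map_pmf fst (coupled \<rho> X i) = prefix_law X i"
  "map_pmf snd (coupled \<rho> X i) = prefix_law X i"
proof (induction i)
  case 0
  {
    case 1 show ?case by (simp add: prefix_law_def restrict_def map_pmf_const)
  next
    case 2 show ?case by (simp add: prefix_law_def restrict_def map_pmf_const)
  }
next
  case (Suc i)
  {
    case 1
    have "map_pmf fst (coupled \<rho> X (Suc i)) = bind_pmf (coupled \<rho> X i)
      (\<lambda>z. map_pmf (\<lambda>a. snoc i (fst z, a)) (map_pmf fst (next_coupling \<rho> X i (fst z) (snd z))))"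
      by (simp add: map_bind_pmf map_pmf_comp case_prod_unfold)
    also have "\<dots> = bind_pmf (map_pmf fst (coupled \<rho> X i))
      (\<lambda>u. map_pmf (\<lambda>a. snoc i (u, a)) (bernoulli_pmf (next_prob X i u)))"
      by (simp add: map_next_coupling bind_map_pmf)
    finally show ?case by (simp add: Suc prefix_law_Suc[OF finX])
  next
    case 2
    have "map_pmf snd (coupled \<rho> X (Suc i)) = bind_pmf (coupled \<rho> X i)
      (\<lambda>z. map_pmf (\<lambda>a. snoc i (snd z, a)) (map_pmf snd (next_coupling \<rho> X i (fst z) (snd z))))"
      by (simp add: map_bind_pmf map_pmf_comp case_prod_unfold)
    also have "\<dots> = bind_pmf (map_pmf snd (coupled \<rho> X i))
      (\<lambda>u. map_pmf (\<lambda>a. snoc i (u, a)) (bernoulli_pmf (next_prob X i u)))"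
      by (simp add: map_next_coupling bind_map_pmf)
    finally show ?case by (simp add: Suc prefix_law_Suc[OF finX])
  }
qed

lemma coupled_swap: "map_pmf prod.swap (coupled \<rho> X i) = coupled \<rho> X i"
proof (induction i)
  case 0
  show ?case by simp
next
  case (Suc i)
  let ?step = "\<lambda>z. map_pmf (\<lambda>w. (snoc i (fst z, fst w), snoc i (snd z, snd w))) (next_coupling \<rho> X i (fst z) (snd z))"
  have step: "map_pmf prod.swap (?step z) = ?step (prod.swap z)" for z
    by (simp add: map_pmf_comp flip: map_next_coupling(4)[of i "fst z" "snd z"])
  have "map_pmf prod.swap (coupled \<rho> X (Suc i)) = bind_pmf (coupled \<rho> X i) (\<lambda>z. ?step (prod.swap z))"
    unfolding step[symmetric] by (simp add: map_bind_pmf case_prod_unfold)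
  also have "\<dots> = bind_pmf (map_pmf prod.swap (coupled \<rho> X i)) ?step"
    by (simp add: bind_map_pmf)
  also have "\<dots> = coupled \<rho> X (Suc i)" unfolding Suc by (simp add: case_prod_unfold)
  finally show ?case .
qed

lemma corr_le_coupled: "corr_le \<rho> (coupled \<rho> X i)"
proof (induction i)
  case 0
  show ?case using corr_le_pair[of "return_pmf (\<lambda>_. undefined)" "return_pmf (\<lambda>_. undefined)" \<rho>] rho by simp
next
  case (Suc i)
  let ?B = "bind_pmf (coupled \<rho> X i)
    (\<lambda>(u, v). map_pmf (\<lambda>(a, b). ((u, a), (v, b))) (next_coupling \<rho> X i u v))"
  have "corr_le \<rho> ?B"
  proof (rule corr_le_bind[where M = "\<lambda>u. bernoulli_pmf (next_prob X i u)"
        and N = "\<lambda>v. bernoulli_pmf (next_prob X i v)", OF finite_coupled _ _ _ Suc])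
    show "corr_le \<rho> (next_coupling \<rho> X i u v)" for u v
      unfolding next_coupling_def
      by (intro or_prob.corr_le_bit_coupling or_prob_next rho phi_near_product next_prob_bounds)
  qed (simp_all add: map_next_coupling)
  moreover have "coupled \<rho> X (Suc i) = map_pmf (map_prod (snoc i) (snoc i)) ?B"
    by (simp add: map_bind_pmf map_pmf_comp case_prod_unfold)
  ultimately show ?case by (simp only: corr_le_map)
qed

text \<open>
  A lower bound for the entropy that coordinate \<open>i + 1\<close> adds to the OR of the two copies.
\<close>

definition gain :: "nat \<Rightarrow> real" where
  "gain i = expect (coupled \<rho> X i) (\<lambda>(u, v). bin_entropy (phi \<rho> (next_prob X i u) (next_prob X i v)))"

lemma phi_next_bounds:
  "0 \<le> phi \<rho> (next_prob X i u) (next_prob X i v)" "phi \<rho> (next_prob X i u) (next_prob X i v) \<le> 1"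
  using or_prob_next[of i u v] next_prob_bounds(1)[of X i u] by (simp_all add: or_prob_def)

lemma gain_nonneg: "0 \<le> gain i"
  unfolding gain_def by (intro expect_nonneg) (auto intro!: bin_entropy_nonneg phi_next_bounds)

text \<open>
  The OR of the prefixes is a function of the pair of prefixes, so its next bit is at least as
  uncertain given the OR as it is given the pair; the latter uncertainty is the gain.
\<close>

lemma sum_gain_le:
  "(\<Sum>i<n. gain i) \<le> shannon (map_pmf (\<lambda>(u, v). or_seq n u v) (coupled \<rho> X n))"
proof (induction n)
  case 0
  show ?case by (simp add: shannon_nonneg)
next
  case (Suc n)
  let ?or = "\<lambda>(u, v). or_seq n u v"
  let ?K = "\<lambda>(u, v). bernoulli_pmf (phi \<rho> (next_prob X n u) (next_prob X n v))"
  let ?J = "bind_pmf (coupled \<rho> X n) (\<lambda>z. map_pmf (Pair (?or z)) (?K z))"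
  have "gain n = expect (coupled \<rho> X n) (\<lambda>z. shannon (?K z))"
    unfolding gain_def
    by (intro expect_cong) (auto simp: shannon_bernoulli phi_next_bounds)
  then have "(\<Sum>i<Suc n. gain i)
      \<le> shannon (map_pmf ?or (coupled \<rho> X n)) + expect (coupled \<rho> X n) (\<lambda>z. shannon (?K z))"
    using Suc by simp
  also have "\<dots> \<le> shannon ?J"
    by (intro shannon_chain_le finite_coupled) (simp add: case_prod_unfold)
  also have "\<dots> = shannon (map_pmf (snoc n) ?J)"
  proof (rule shannon_map_inj[symmetric], rule inj_on_subset[OF inj_on_snoc])
    show "set_pmf ?J \<subseteq> cube n \<times> UNIV" by (auto simp: cube_def or_seq_def)
  qed
  also have "map_pmf (snoc n) ?J = map_pmf (\<lambda>(u, v). or_seq (Suc n) u v) (coupled \<rho> X (Suc n))"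
  proof -
    have "map_pmf (snoc n) ?J = bind_pmf (coupled \<rho> X n) (\<lambda>(u, v). map_pmf (\<lambda>c. snoc n (or_seq n u v, c))
        (map_pmf (\<lambda>(a, b). a \<or> b) (next_coupling \<rho> X n u v)))"
      unfolding map_next_coupling(3) by (simp add: map_bind_pmf map_pmf_comp case_prod_unfold)
    then show ?thesis
      by (simp add: map_bind_pmf map_pmf_comp case_prod_unfold or_seq_snoc)
  qed
  finally show ?case .
qed

end

section \<open>Extracting the bound from \<open>\<Gamma>\<close>\<close>

definition coupling_ratio :: "real \<Rightarrow> real pmf \<Rightarrow> real" where
  "coupling_ratio \<rho> P = (INF Q \<in> {Q \<in> sym_couplings P. maximal_corr Q \<le> \<rho>}.
     expect Q (\<lambda>(p, q). bin_entropy (phi \<rho> p q)) / expect P bin_entropy)"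

lemma sym_coupling_quotient_nonneg:
  assumes "P \<in> fin_dists" "Q \<in> sym_couplings P" "0 \<le> \<rho>"
  shows "0 \<le> expect Q (\<lambda>(p, q). bin_entropy (phi \<rho> p q)) / expect P bin_entropy"
proof -
  have P: "set_pmf P \<subseteq> {0..1}" and Q: "set_pmf P = fst ` set_pmf Q" "set_pmf P = snd ` set_pmf Q"
    using assms by (auto simp: fin_dists_def sym_couplings_def simp flip: set_map_pmf)
  have "0 \<le> expect Q (\<lambda>(p, q). bin_entropy (phi \<rho> p q))"
  proof (rule expect_nonneg, clarify)
    fix p q assume "(p, q) \<in> set_pmf Q"
    then have "p \<in> set_pmf P" "q \<in> set_pmf P" using Q by force+
    then have pq: "0 \<le> p" "p \<le> 1" "0 \<le> q" "q \<le> 1" using P by auto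
    then have "or_prob p q (phi \<rho> p q)" using assms(3) by (intro or_prob_phi)
    then show "0 \<le> bin_entropy (phi \<rho> p q)" using pq by (intro bin_entropy_nonneg) (auto simp: or_prob_def)
  qed
  moreover have "0 \<le> expect P bin_entropy"
    using P by (intro expect_nonneg bin_entropy_nonneg) auto
  ultimately show ?thesis by simp
qed

lemma coupling_ratio_le:
  assumes "P \<in> fin_dists" "Q \<in> sym_couplings P" "maximal_corr Q \<le> \<rho>" "0 \<le> \<rho>"
  shows "coupling_ratio \<rho> P \<le> expect Q (\<lambda>(p, q). bin_entropy (phi \<rho> p q)) / expect P bin_entropy"
  unfolding coupling_ratio_def
  using assms by (intro cINF_lower bdd_belowI2[where m = 0] sym_coupling_quotient_nonneg) auto

text \<open>
  The independent coupling shows that the infimum ranges over a nonempty set.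
\<close>

lemma coupling_ratio_nonneg:
  assumes "P \<in> fin_dists" "0 \<le> \<rho>"
  shows "0 \<le> coupling_ratio \<rho> P"
proof -
  have fin: "finite (set_pmf P)" using assms by (simp add: fin_dists_def)
  have "maximal_corr (pair_pmf P P) \<le> \<rho>"
    using fin assms by (intro maximal_corr_le corr_le_pair) auto
  moreover have "pair_pmf P P \<in> sym_couplings P"
    by (auto simp: sym_couplings_def map_fst_pair_pmf map_snd_pair_pmf pmf_pair)
  ultimately have "{Q \<in> sym_couplings P. maximal_corr Q \<le> \<rho>} \<noteq> {}" by blast
  then show ?thesis
    unfolding coupling_ratio_def using assms
    by (intro cINF_greatest sym_coupling_quotient_nonneg) auto
qed

text \<open>
  A supremum above 1 is witnessed by a single law \<open>R\<close> of \<open>\<rho>\<close> that works uniformly in \<open>P\<close>. Nonnegativity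
  of the ratios bounds the infimum over \<open>P\<close> from below, which makes it a lower bound for its members.
\<close>

lemma Gamma_fun_gt_1E:
  assumes "1 < Gamma_fun t"
  obtains R c where "R \<in> fin_dists" "1 < c"
    "\<And>P. P \<in> fin_dists \<Longrightarrow> 0 < expect P bin_entropy \<Longrightarrow> expect P (\<lambda>p. p) \<le> t
      \<Longrightarrow> c \<le> expect R (\<lambda>\<rho>. coupling_ratio \<rho> P)"
proof -
  let ?F = "{P \<in> fin_dists. 0 < expect P bin_entropy \<and> expect P (\<lambda>p. p) \<le> t}"
  define I where "I R = (INF P \<in> ?F. expect R (\<lambda>\<rho>. coupling_ratio \<rho> P))" for R
  have Gamma: "Gamma_fun t = (SUP R \<in> fin_dists. I R)"
    by (simp add: Gamma_fun_def I_def coupling_ratio_def)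
  have "return_pmf 0 \<in> fin_dists" by (simp add: fin_dists_def)
  then have "\<exists>R\<in>fin_dists. 1 < I R"
    using assms cSUP_least[of fin_dists I 1] unfolding Gamma by fastforce
  then obtain R where R: "R \<in> fin_dists" "1 < I R" by blast
  have "I R \<le> expect R (\<lambda>\<rho>. coupling_ratio \<rho> P)" if "P \<in> ?F" for P
    unfolding I_def
  proof (rule cINF_lower[OF bdd_belowI2[where m = 0] that])
    fix P assume "P \<in> ?F"
    then show "0 \<le> expect R (\<lambda>\<rho>. coupling_ratio \<rho> P)"
      using R(1) by (intro expect_nonneg coupling_ratio_nonneg) (auto simp: fin_dists_def)
  qed
  then show ?thesis using that R by blast
qed

text \<open>
  The conditional probabilities of the next bits, evaluated at the coupled prefixes, form a symmetric
  coupling of maximal correlation at most \<open>\<rho>\<close>, hence a competitor in the infimum.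
\<close>

lemma (in coupling_process) coupling_ratio_le_gain:
  assumes "0 < expect (prefix_law X i) (\<lambda>u. bin_entropy (next_prob X i u))"
  shows "coupling_ratio \<rho> (map_pmf (next_prob X i) (prefix_law X i))
    \<le> gain i / expect (prefix_law X i) (\<lambda>u. bin_entropy (next_prob X i u))"
proof -
  let ?k = "next_prob X i"
  let ?P = "map_pmf ?k (prefix_law X i)"
  let ?Q = "map_pmf (map_prod ?k ?k) (coupled \<rho> X i)"
  have P: "?P \<in> fin_dists"
    using finX by (auto simp: fin_dists_def prefix_law_def next_prob_bounds)
  have swap: "map_pmf prod.swap ?Q = ?Q"
    by (subst (2) coupled_swap[symmetric])
       (simp add: map_pmf_comp prod.swap_def map_prod_def case_prod_unfold)
  have "map_pmf fst ?Q = ?P" "map_pmf snd ?Q = ?P"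
    by (simp add: map_pmf_comp flip: coupled_marginals(1), simp add: map_pmf_comp flip: coupled_marginals(2))
  moreover have "pmf ?Q (x, y) = pmf ?Q (y, x)" for x y
    using pmf_map_inj'[OF inj_swap, of ?Q "(y, x)"] unfolding swap by simp
  ultimately have Q: "?Q \<in> sym_couplings ?P" by (simp add: sym_couplings_def)
  have "maximal_corr ?Q \<le> \<rho>"
    using finite_coupled by (intro maximal_corr_le corr_le_map corr_le_coupled rho) simp
  from coupling_ratio_le[OF P Q this rho] show ?thesis
    by (simp add: gain_def map_prod_def case_prod_unfold)
qed

text \<open>
  If \<open>R\<close> witnessed \<open>\<Gamma>(t) > 1\<close>, then averaging over \<open>\<rho>\<close> drawn from \<open>R\<close> each coordinate would contribute at
  least \<open>c > 1\<close> times as much entropy to the OR of the coupled copies as to a single copy. Summing over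
  the coordinates contradicts that the OR stays inside \<open>A\<close>, on which a single copy is uniform.
\<close>

lemma Gamma_fun_le_1_if_coordinates_rare:
  assumes A: "A \<subseteq> cube n" "or_closed n A" "1 < card A"
    and rare: "\<And>i. i \<in> {1..n} \<Longrightarrow> measure (pmf_of_set A) {x. x i} \<le> t"
  shows "Gamma_fun t \<le> 1"
proof (rule ccontr)
  assume "\<not> Gamma_fun t \<le> 1"
  then have "1 < Gamma_fun t" by simp
  then obtain R c where R: "R \<in> fin_dists" and c: "1 < c"
    and Rc: "\<And>P. P \<in> fin_dists \<Longrightarrow> 0 < expect P bin_entropy \<Longrightarrow> expect P (\<lambda>p. p) \<le> t
      \<Longrightarrow> c \<le> expect R (\<lambda>\<rho>. coupling_ratio \<rho> P)"
    by (rule Gamma_fun_gt_1E) blast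
  have finA: "finite A" "A \<noteq> {}" using A(3) by (auto intro: card_ge_0_finite)
  define X where "X = pmf_of_set A"
  have setX: "set_pmf X = A" using finA by (simp add: X_def)
  have finR: "finite (set_pmf R)" and R01: "\<And>\<rho>. \<rho> \<in> set_pmf R \<Longrightarrow> 0 \<le> \<rho>"
    using R by (auto simp: fin_dists_def)
  have proc: "coupling_process \<rho> X" if "\<rho> \<in> set_pmf R" for \<rho>
    using that R01 finA by unfold_locales (auto simp: setX)
  have finX: "finite (set_pmf X)" using setX finA by simp
  have "prefix_law X n = map_pmf id X"
    unfolding prefix_law_def using A(1)
    by (intro map_pmf_cong) (auto simp: setX cube_def PiE_restrict)
  then have prefix_n: "prefix_law X n = X" by simp
  let ?H = "\<lambda>i. expect (prefix_law X i) (\<lambda>u. bin_entropy (next_prob X i u))"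
  have total: "(\<Sum>i<n. ?H i) = log 2 (card A)"
    using shannon_prefix_law[OF finX, of n] shannon_pmf_of_set[OF finA]
    unfolding prefix_n X_def[symmetric] by simp
  have step: "c * ?H i \<le> expect R (\<lambda>\<rho>. coupling_process.gain \<rho> X i)" if i: "i < n" for i
  proof -
    let ?P = "map_pmf (next_prob X i) (prefix_law X i)"
    have gain0: "0 \<le> coupling_process.gain \<rho> X i" if "\<rho> \<in> set_pmf R" for \<rho>
      using coupling_process.gain_nonneg[OF proc[OF that]] .
    have H0: "0 \<le> ?H i" by (intro expect_nonneg bin_entropy_nonneg next_prob_bounds)
    show ?thesis
    proof (cases "?H i = 0")
      \<comment> \<open>A coordinate determined by its predecessors gives no test law for \<open>\<Gamma>\<close>, but contributes nothing.\<close>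
      case True
      then show ?thesis using gain0 by (simp add: expect_nonneg)
    next
      case False
      with H0 have H: "0 < ?H i" by simp
      have "c \<le> expect R (\<lambda>\<rho>. coupling_ratio \<rho> ?P)"
      proof (rule Rc)
        show "?P \<in> fin_dists" using finX by (auto simp: fin_dists_def prefix_law_def next_prob_bounds)
        show "0 < expect ?P bin_entropy" using H by simp
        show "expect ?P (\<lambda>p. p) \<le> t"
          using rare[of "Suc i"] i expect_next_prob[OF finX, of i] by (simp add: X_def)
      qed
      also have "\<dots> \<le> expect R (\<lambda>\<rho>. (1 / ?H i) * coupling_process.gain \<rho> X i)"
        using coupling_process.coupling_ratio_le_gain[OF proc H] by (intro expect_mono finR) simp
      also have "\<dots> = expect R (\<lambda>\<rho>. coupling_process.gain \<rho> X i) / ?H i"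
        unfolding expect_linear(4)[OF finR] by simp
      finally show ?thesis using H by (simp add: pos_le_divide_eq)
    qed
  qed
  have "c * log 2 (card A) \<le> (\<Sum>i<n. expect R (\<lambda>\<rho>. coupling_process.gain \<rho> X i))"
    unfolding total[symmetric] sum_distrib_left using step by (intro sum_mono) auto
  also have "\<dots> = expect R (\<lambda>\<rho>. \<Sum>i<n. coupling_process.gain \<rho> X i)"
    by (rule Bochner_Integration.integral_sum[symmetric]) (simp add: integrable_measure_pmf_finite finR)
  also have "\<dots> \<le> expect R (\<lambda>\<rho>. log 2 (card A))"
  proof (rule expect_mono[OF finR])
    fix \<rho> assume "\<rho> \<in> set_pmf R"
    then interpret coupling_process \<rho> X by (rule proc)
    have "set_pmf (map_pmf (\<lambda>(u, v). or_seq n u v) (coupled \<rho> X n)) \<subseteq> A"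
    proof clarsimp
      fix u v assume "(u, v) \<in> set_pmf (coupled \<rho> X n)"
      then have "u \<in> set_pmf (map_pmf fst (coupled \<rho> X n))" "v \<in> set_pmf (map_pmf snd (coupled \<rho> X n))"
        by force+
      then have "u \<in> A" "v \<in> A" unfolding coupled_marginals prefix_n setX by auto
      then show "or_seq n u v \<in> A" using A(2) by (simp add: or_closed_def)
    qed
    then show "(\<Sum>i<n. gain i) \<le> log 2 (card A)"
      using sum_gain_le[of n] shannon_le_log_card[OF finA(1)] by (meson order.trans)
  qed
  finally have "c * log 2 (card A) \<le> log 2 (card A)" by simp
  moreover have "0 < log 2 (card A)" using A(3) by simp
  ultimately show False using c by simp
qed

text \<open>
  For \<open>A = {x}\<close> the entropy argument is void since \<open>log 2 (card A) = 0\<close>; there some \<open>x\<^sub>i\<close> is 1, so that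
  coordinate is 1 with probability 1.
\<close>

lemma p_max_ge:
  assumes "t \<le> 1" and "Gamma_fun t > 1"
    and A: "A \<subseteq> cube n" "A \<noteq> {}" "A \<noteq> {zero_seq n}" "or_closed n A"
  shows "t \<le> p_max n A"
proof (rule ccontr)
  let ?p = "\<lambda>i. measure (pmf_of_set A) {x. x i}"
  assume "\<not> t \<le> p_max n A"
  moreover have "?p i \<le> p_max n A" if "i \<in> {1..n}" for i
    unfolding p_max_def using that by (intro Max_ge finite_imageI finite_atLeastAtMost imageI)
  ultimately have rare: "?p i < t" if "i \<in> {1..n}" for i
    using that by fastforce
  have "finite (cube n)" unfolding cube_def by (intro finite_PiE) auto
  then have finA: "finite A" using A(1) finite_subset by blast
  have "1 < card A"
  proof (rule ccontr)
    assume "\<not> 1 < card A"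
    moreover have "0 < card A" using A(2) finA by (simp add: card_gt_0_iff)
    ultimately have "card A = 1" by linarith
    then obtain x where x: "A = {x}" by (auto simp: card_1_singleton_iff)
    have "\<exists>i\<in>{1..n}. x i"
    proof (rule ccontr)
      assume "\<not> (\<exists>i\<in>{1..n}. x i)"
      moreover have "x j = undefined" if "j \<notin> {1..n}" for j
        using A(1) x that PiE_arb[of x "{1..n}" _ j] by (auto simp: cube_def)
      ultimately have "x = zero_seq n"
        by (auto simp: zero_seq_def fun_eq_iff restrict_def)
      then show False using A(3) x by simp
    qed
    then obtain i where "i \<in> {1..n}" "x i" by blast
    then have "?p i = 1" by (simp add: x pmf_of_set_singleton)
    then show False using rare[OF \<open>i \<in> {1..n}\<close>] \<open>t \<le> 1\<close> by simp
  qed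
  then have "Gamma_fun t \<le> 1"
    using rare A by (intro Gamma_fun_le_1_if_coordinates_rare[of A n]) (auto intro: less_imp_le)
  then show False using \<open>Gamma_fun t > 1\<close> by simp
qed

theorem theorem1:
  fixes t :: real and n :: nat
  assumes "n \<ge> 1"
    and "0 < t" and "t < 1 / 2"
    and "Gamma_fun t > 1"
  shows "(\<forall>A. A \<subseteq> cube n \<and> A \<noteq> {} \<and> A \<noteq> {zero_seq n} \<and> or_closed n A \<longrightarrow> p_max n A \<ge> t) \<and>
    (\<forall>F. F \<subseteq> Pow {1..n} \<and> F \<noteq> {} \<and> F \<noteq> {{}} \<and> union_closed F \<longrightarrow>
      (\<exists>i\<in>{1..n}. real (card {S \<in> F. i \<in> S}) \<ge> t * real (card F)))"
proof (intro conjI allI impI)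
  fix A assume "A \<subseteq> cube n \<and> A \<noteq> {} \<and> A \<noteq> {zero_seq n} \<and> or_closed n A"
  moreover have "t \<le> 1" using assms by linarith
  ultimately show "p_max n A \<ge> t" using p_max_ge assms by blast
next
  fix F :: "nat set set"
  assume F: "F \<subseteq> Pow {1..n} \<and> F \<noteq> {} \<and> F \<noteq> {{}} \<and> union_closed F"
  define ind :: "nat set \<Rightarrow> nat \<Rightarrow> bool" where "ind S = (\<lambda>i\<in>{1..n}. i \<in> S)" for S
  have ind: "ind S i \<longleftrightarrow> i \<in> S" if "i \<in> {1..n}" for S i using that by (simp add: ind_def)
  have inj: "inj_on ind (Pow {1..n})"
    by (rule inj_onI, rule set_eqI) (metis ind Pow_iff subsetD)
  have injF: "inj_on ind F" using F inj_on_subset[OF inj] by blast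
  have finF: "finite F" using F finite_subset[of F "Pow {1..n}"] by auto
  have "ind ` F \<subseteq> cube n" by (auto simp: ind_def cube_def)
  moreover have "ind ` F \<noteq> {zero_seq n}"
  proof
    have z: "zero_seq n = ind {}" by (simp add: zero_seq_def ind_def)
    assume "ind ` F = {zero_seq n}"
    then have "ind ` F = ind ` {{}}" by (simp add: z)
    then show False using F inj_on_image_eq_iff[OF inj, of F "{{}}"] by auto
  qed
  moreover have "or_closed n (ind ` F)"
    unfolding or_closed_def
  proof clarify
    fix S T assume ST: "S \<in> F" "T \<in> F"
    then have "S \<union> T \<in> F" using F by (auto simp: union_closed_def)
    moreover have "or_seq n (ind S) (ind T) = ind (S \<union> T)"
      by (auto simp: or_seq_def ind_def fun_eq_iff restrict_def)
    ultimately show "or_seq n (ind S) (ind T) \<in> ind ` F" by simp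
  qed
  ultimately have "t \<le> p_max n (ind ` F)" using assms F by (intro p_max_ge) auto
  then obtain i where i: "i \<in> {1..n}" "t \<le> measure (pmf_of_set (ind ` F)) {x. x i}"
    unfolding p_max_def using \<open>n \<ge> 1\<close> by (subst (asm) Max_ge_iff) auto
  have F_nonempty: "ind ` F \<noteq> {}" using F by simp
  have restr: "ind ` F \<inter> {x. x i} = ind ` {S \<in> F. i \<in> S}" using ind[OF i(1)] by auto
  have injFi: "inj_on ind {S \<in> F. i \<in> S}" by (rule inj_on_subset[OF injF]) auto
  have "measure_pmf.prob (pmf_of_set (ind ` F)) {x. x i}
      = real (card {S \<in> F. i \<in> S}) / real (card F)"
    unfolding measure_pmf_of_set[OF F_nonempty finite_imageI[OF finF]] restr
      card_image[OF injF] card_image[OF injFi] ..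
  then have le: "t \<le> real (card {S \<in> F. i \<in> S}) / real (card F)"
    using i(2) by (rule ord_le_eq_trans[rotated])
  have "0 < real (card F)" using F finF by (simp add: card_gt_0_iff)
  then have "t * real (card F) \<le> real (card {S \<in> F. i \<in> S})"
    using le by (rule pos_le_divide_eq[THEN iffD1])
  then show "\<exists>i\<in>{1..n}. real (card {S \<in> F. i \<in> S}) \<ge> t * real (card F)" using i(1) by blast
qed

end
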